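(* Let $k\ge1$, $m=2^{k-1}$, $r\ge0$, $n=2^r$, and $I=(i_1,\dots,i_k)$ nonnegative integers with $i_1+2i_2+\dots+k\,i_k=r$. The code $\mathcal D_I=\mathcal H_I^\perp$ is a linear $(n,\,n2^k,\,n2^{k-2})^*$-code with generator matrix $B_I$, and the corresponding $Z_{2^k}$-linear code $D_I=\varphi(\mathcal D_I)$ is a binary $(n2^{k-1},\,n2^k,\,n2^{k-2})$-code, i.e. a Hadamard code.
   Context: $B_I$ is the matrix whose columns are all elements of $\{1\}\times(2^{k-1}Z_{2^k})^{i_1}\times\dots\times(2^0Z_{2^k})^{i_k}$ in lexicographic order, and $\mathcal H_I=\{\bar h\in Z_{2^k}^n:B_I\bar h^T=\bar0\}$; $\perp$ denotes the dual with respect to $\sum_ix_iy_i$. Define $wt^*(0)=0$, $wt^*(m)=m$, $wt^*(x)=m/2$ otherwise on $Z_{2^k}$, $d^*(\bar x,\bar y)=\sum_iwt^*(y_i-x_i)$; an $(n,M,d)^*$-code is a subset of $Z_{2^k}^n$ of size $M$ with pairwise $d^*$-distance at least $d$. Let $A=\{a_0,\dots,a_{2m-1}\}\subset Z_2^m$ be a binary $(m,2m,m/2)$-code with $a_0=\bar0$ and $a_i+a_{i+m}$ the all-one word for $0\le i<m$; $\varphi(x_1,\dots,x_n)=(a_{x_1},\dots,a_{x_n})$ and $\varphi(\mathcal C)=\{\varphi(\bar x):\bar x\in\mathcal C\}$. A binary $(N,M,d)$-code is a subset of $Z_2^N$ of size $M$ with pairwise Hamming distance at least $d$. *)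

theory Defs
  imports
    "Jordan_Normal_Form.Matrix_Kernel"
    "HOL-Library.Word"
    "HOL-Library.Z2"
    "HOL-Library.List_Lexorder"
begin

text \<open>
  The ring of integers modulo \<open>2 ^ k\<close> is the type \<^typ>\<open>'k word\<close> with \<open>k = LENGTH('k)\<close>.  The class
  \<^class>\<open>len\<close> forces \<open>k \<ge> 1\<close>, and every positive \<open>k\<close> is the length of some numeral type.
\<close>

text \<open>
  \<open>I j\<close> is the entry \<open>i\<^sub>j\<close> for \<open>1 \<le> j \<le> k\<close>; the other values of \<open>I\<close> are not used.
  Lists are compared lexicographically and words by their representatives in
  \<open>{0..<2 ^ k}\<close>, so \<^const>\<open>sorted_list_of_set\<close> puts the columns in lexicographic order.
\<close>

definition B_columns :: "(nat \<Rightarrow> nat) \<Rightarrow> 'k::len word list set" where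
  "B_columns I =
     listset ({1} # concat (map (\<lambda>j. replicate (I j) (range (\<lambda>x. 2 ^ (LENGTH('k) - j) * x)))
                             [1..<LENGTH('k) + 1]))"

definition B_mat :: "(nat \<Rightarrow> nat) \<Rightarrow> 'k::len word mat" where
  "B_mat I = mat_of_cols_list (1 + (\<Sum>j=1..LENGTH('k). I j)) (sorted_list_of_set (B_columns I))"

definition H_code :: "(nat \<Rightarrow> nat) \<Rightarrow> 'k::len word vec set" where
  "H_code I = mat_kernel (B_mat I)"

definition dual_code :: "nat \<Rightarrow> 'a::comm_ring_1 vec set \<Rightarrow> 'a vec set" where
  "dual_code n C = {x \<in> carrier_vec n. \<forall>y\<in>C. x \<bullet> y = 0}"

definition linear_code :: "nat \<Rightarrow> 'a::comm_ring_1 vec set \<Rightarrow> bool" where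
  "linear_code n C \<longleftrightarrow> C \<subseteq> carrier_vec n \<and> 0\<^sub>v n \<in> C \<and>
     (\<forall>x\<in>C. \<forall>y\<in>C. x + y \<in> C) \<and> (\<forall>c. \<forall>x\<in>C. c \<cdot>\<^sub>v x \<in> C)"

definition generator_matrix :: "nat \<Rightarrow> 'a::comm_ring_1 mat \<Rightarrow> 'a vec set \<Rightarrow> bool" where
  "generator_matrix n G C \<longleftrightarrow>
     dim_col G = n \<and> C = {transpose_mat G *\<^sub>v u | u. u \<in> carrier_vec (dim_row G)}"

definition wt_star :: "'k::len word \<Rightarrow> real" where
  "wt_star x =
     (let m = 2 ^ (LENGTH('k) - 1) :: nat
      in if x = 0 then 0 else if x = of_nat m then real m else real m / 2)"

definition d_star :: "'k::len word vec \<Rightarrow> 'k word vec \<Rightarrow> real" where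
  "d_star x y = (\<Sum>i<dim_vec x. wt_star (y $ i - x $ i))"

text \<open>
  The distance parameters are real because \<open>m / 2\<close> and \<open>n * 2 powi (k - 2)\<close>
  need not be integers when \<open>k = 1\<close>.
\<close>

definition star_code :: "nat \<Rightarrow> nat \<Rightarrow> real \<Rightarrow> 'k::len word vec set \<Rightarrow> bool" where
  "star_code n M d C \<longleftrightarrow> C \<subseteq> carrier_vec n \<and> finite C \<and> card C = M \<and>
     (\<forall>x\<in>C. \<forall>y\<in>C. x \<noteq> y \<longrightarrow> d_star x y \<ge> d)"

definition hamming_dist :: "'a vec \<Rightarrow> 'a vec \<Rightarrow> nat" where
  "hamming_dist x y = card {i. i < dim_vec x \<and> x $ i \<noteq> y $ i}"

definition binary_code :: "nat \<Rightarrow> nat \<Rightarrow> real \<Rightarrow> bit vec set \<Rightarrow> bool" where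
  "binary_code N M d C \<longleftrightarrow> C \<subseteq> carrier_vec N \<and> finite C \<and> card C = M \<and>
     (\<forall>x\<in>C. \<forall>y\<in>C. x \<noteq> y \<longrightarrow> real (hamming_dist x y) \<ge> d)"

definition hadamard_code :: "nat \<Rightarrow> bit vec set \<Rightarrow> bool" where
  "hadamard_code N C \<longleftrightarrow> binary_code N (2 * N) (real N / 2) C"

definition phi :: "(nat \<Rightarrow> bit vec) \<Rightarrow> 'k::len word vec \<Rightarrow> bit vec" where
  "phi a x = vec_of_list (concat (map (\<lambda>c. list_of_vec (a (unat c))) (list_of_vec x)))"

end

theory Submission
  imports Defs
begin

text \<open>
  The rows of the matrix span the functions \<open>p \<mapsto> c + u \<bullet> p\<close> on the group \<open>G\<close> of column tails.
  An additive map from \<open>2 ^ (k - j) Z\<close> to \<open>Z / 2 ^ k\<close> is multiplication by a scalar, so every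
  additive map on \<open>G\<close> is of the form \<open>p \<mapsto> u \<bullet> p\<close>; this gives both the duality and the size of the code.
  If \<open>u \<bullet> p\<close> does not vanish on \<open>G\<close>, it takes the value \<open>m = 2 ^ (k - 1)\<close> at some \<open>h\<close>.
  Since \<open>wt_star x + wt_star (x + m) = m\<close> for all \<open>x\<close>, translation by \<open>h\<close> shows that the
  weight of such a codeword is \<open>n m / 2\<close>.
\<close>


section \<open>Inner products of lists\<close>

text \<open>Lists take the place of vectors so that facts on products of cyclic groups can be proved
  by induction on the factors.\<close>

definition dot :: "'a::comm_ring_1 list \<Rightarrow> 'a list \<Rightarrow> 'a" where
  "dot u p = sum_list (map2 (*) u p)"

lemma dot_simps [simp]:
  "dot [] p = 0" "dot u [] = 0" "dot (c # u) (x # p) = c * x + dot u p"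
  by (simp_all add: dot_def)

lemma dot_zero: "dot u (replicate l 0) = 0"
proof (induction u arbitrary: l)
  case (Cons c u)
  then show ?case by (cases l) auto
qed simp

lemma dot_map_times: "dot u (map ((*) c) p) = c * dot u p"
proof (induction u arbitrary: p)
  case (Cons a u)
  then show ?case by (cases p) (auto simp: algebra_simps)
qed simp

lemma dot_map2_plus:
  "length p = length u \<Longrightarrow> length q = length u \<Longrightarrow> dot u (map2 (+) p q) = dot u p + dot u q"
proof (induction u arbitrary: p q)
  case (Cons a u)
  from Cons.prems obtain x p' y q' where "p = x # p'" "q = y # q'" "length p' = length u" "length q' = length u"
    by (auto simp: length_Suc_conv)
  then show ?case by (simp add: Cons.IH distrib_left)
qed simp

section \<open>Arithmetic modulo \<open>2 ^ k\<close> and the subgroups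
  \<open>2 ^ (k - e) Z\<close>\<close>

text \<open>Indexed by the exponent of the order: for \<open>e \<le> LENGTH('k)\<close> this is the
  subgroup with \<open>2 ^ e\<close> elements.\<close>

definition pow2_multiples :: "nat \<Rightarrow> 'k::len word set" where
  "pow2_multiples e = range (\<lambda>x. 2 ^ (LENGTH('k) - e) * x)"

text \<open>Divisibility of \<open>2 * unat z\<close> by \<open>2 ^ k\<close> makes
  \<open>unat z\<close> a multiple of \<open>2 ^ (k - 1)\<close>, and \<open>unat z < 2 ^ k\<close>
  leaves only the quotients 0 and 1.\<close>

lemma word_eq_0_or_half:
  fixes z :: "'k::len word"
  assumes "2 * z = 0"
  shows "z = 0 \<or> z = 2 ^ (LENGTH('k) - 1)"
proof -
  have L: "2 ^ LENGTH('k) = (2 * 2 ^ (LENGTH('k) - 1) :: nat)"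
    by (metis One_nat_def Suc_pred len_gt_0 power_Suc)
  have "of_nat (2 * unat z) = (0 :: 'k word)" using assms by simp
  then have "2 ^ LENGTH('k) dvd 2 * unat z" by (simp only: word_of_nat_eq_0_iff)
  then have "2 ^ (LENGTH('k) - 1) dvd unat z" unfolding L by simp
  then obtain q where q: "unat z = 2 ^ (LENGTH('k) - 1) * q" by (elim dvdE)
  have "unat z < 2 * 2 ^ (LENGTH('k) - 1)" unfolding L[symmetric] by (rule unsigned_less)
  then have "q < 2" using q by simp
  then have "q = 0 \<or> q = 1" by auto
  moreover have "z = of_nat (2 ^ (LENGTH('k) - 1) * q)" unfolding q[symmetric] by simp
  ultimately show ?thesis by auto
qed

lemma two_times_half: "2 * 2 ^ (LENGTH('k) - 1) = (0 :: 'k::len word)"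
proof -
  have "2 * 2 ^ (LENGTH('k) - 1) = (2 ^ LENGTH('k) :: 'k word)"
    by (metis One_nat_def Suc_pred len_gt_0 power_Suc)
  then show ?thesis by simp
qed

lemma half_nonzero: "2 ^ (LENGTH('k) - 1) \<noteq> (0 :: 'k::len word)"
proof -
  have "\<not> 2 ^ LENGTH('k) dvd (2 ^ (LENGTH('k) - 1) :: nat)"
    by (simp add: dvd_power_iff_le)
  then show ?thesis using word_of_nat_eq_0_iff[of "2 ^ (LENGTH('k) - 1)", where 'a='k] by simp
qed

text \<open>The sequence \<open>w\<close>, \<open>2 * w\<close>, \<open>4 * w\<close>, ... reaches
  0. Its last nonzero term is annihilated by 2, hence equal to \<open>2 ^ (k - 1)\<close>.\<close>

lemma ex_times_eq_half:
  fixes w :: "'k::len word"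
  assumes "w \<noteq> 0"
  shows "\<exists>y. y * w = 2 ^ (LENGTH('k) - 1)"
proof -
  define s where "s = (LEAST s. 2 ^ s * w = 0)"
  have "2 ^ LENGTH('k) * w = 0" by simp
  then have s: "2 ^ s * w = 0" unfolding s_def by (rule LeastI)
  with assms obtain t where t: "s = Suc t" by (cases s) auto
  have "2 ^ t * w \<noteq> 0" using not_less_Least[of t "\<lambda>s. 2 ^ s * w = 0"] t s_def by auto
  moreover have "2 * (2 ^ t * w) = 0" using s t by (simp add: mult.assoc)
  ultimately show ?thesis using word_eq_0_or_half by blast
qed

text \<open>Cancel \<open>2 ^ e\<close> in \<open>2 ^ k dvd 2 ^ e * unat c\<close>. This will locate
  the image of a generator of order \<open>2 ^ e\<close> under an additive map.\<close>

lemma annihilated_by_pow2: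
  fixes c :: "'k::len word"
  assumes "2 ^ e * c = 0" "e \<le> LENGTH('k)"
  shows "\<exists>u. c = 2 ^ (LENGTH('k) - e) * u"
proof -
  have "of_nat (2 ^ e * unat c) = (0 :: 'k word)" using assms by simp
  then have "2 ^ LENGTH('k) dvd 2 ^ e * unat c" by (simp only: word_of_nat_eq_0_iff)
  moreover have "(2 :: nat) ^ LENGTH('k) = 2 ^ e * 2 ^ (LENGTH('k) - e)"
    using assms(2) by (simp flip: power_add)
  ultimately have "2 ^ (LENGTH('k) - e) dvd unat c" by simp
  then obtain q where q: "unat c = 2 ^ (LENGTH('k) - e) * q" by (elim dvdE)
  have "c = of_nat (2 ^ (LENGTH('k) - e) * q)" unfolding q[symmetric] by simp
  then show ?thesis by auto
qed

lemma card_pow2_multiples: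
  assumes "e \<le> LENGTH('k::len)"
  shows "card (pow2_multiples e :: 'k word set) = 2 ^ e"
proof -
  let ?f = "\<lambda>x. of_nat (2 ^ (LENGTH('k) - e) * x) :: 'k word"
  have E: "(2 :: nat) ^ LENGTH('k) = 2 ^ (LENGTH('k) - e) * 2 ^ e"
    using assms by (simp flip: power_add)
  have "inj_on ?f {..<2 ^ e}"
  proof (rule inj_onI)
    fix x y :: nat
    assume xy: "x \<in> {..<2 ^ e}" "y \<in> {..<2 ^ e}" "?f x = ?f y"
    then have "unat (?f x) = unat (?f y)" by simp
    then have "2 ^ (LENGTH('k) - e) * x mod 2 ^ LENGTH('k) = 2 ^ (LENGTH('k) - e) * y mod 2 ^ LENGTH('k)"
      by (simp only: unat_of_nat)
    then show "x = y" using xy unfolding E by simp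
  qed
  moreover have "?f ` {..<2 ^ e} = pow2_multiples e"
  proof (intro equalityI subsetI)
    fix z :: "'k word" assume "z \<in> pow2_multiples e"
    then obtain x where z: "z = 2 ^ (LENGTH('k) - e) * x" by (auto simp: pow2_multiples_def)
    \<comment> \<open>Reducing the cofactor modulo \<open>2 ^ e\<close> changes the product by a
      multiple of \<open>2 ^ k\<close>.\<close>
    have "?f (unat x) = ?f (unat x mod 2 ^ e)"
      by (rule word_unat_eq_iff[THEN iffD2]) (simp only: unat_of_nat E mod_mult_mult1 mod_mod_trivial)
    then show "z \<in> ?f ` {..<2 ^ e}" using z by (intro image_eqI[of _ _ "unat x mod 2 ^ e"]) auto
  qed (auto simp: pow2_multiples_def)
  ultimately show ?thesis using card_image[of ?f "{..<2 ^ e}"] by simp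
qed

lemma pow2_multiples_closed [simp]:
  "0 \<in> pow2_multiples e" "(2 :: 'k::len word) ^ (LENGTH('k) - e) \<in> pow2_multiples e"
  "(x :: 'k::len word) \<in> pow2_multiples e \<Longrightarrow> y \<in> pow2_multiples e \<Longrightarrow> x + y \<in> pow2_multiples e"
  "(x :: 'k::len word) \<in> pow2_multiples e \<Longrightarrow> c * x \<in> pow2_multiples e"
proof -
  show "0 \<in> pow2_multiples e"
    unfolding pow2_multiples_def by (rule range_eqI[of _ _ 0]) simp
  show "(2 :: 'k word) ^ (LENGTH('k) - e) \<in> pow2_multiples e"
    unfolding pow2_multiples_def by (rule range_eqI[of _ _ 1]) simp
  show "(x :: 'k word) \<in> pow2_multiples e \<Longrightarrow> y \<in> pow2_multiples e \<Longrightarrow> x + y \<in> pow2_multiples e" 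
    unfolding pow2_multiples_def by (auto simp flip: distrib_left)
  show "(x :: 'k word) \<in> pow2_multiples e \<Longrightarrow> c * x \<in> pow2_multiples e"
    unfolding pow2_multiples_def by (auto simp: mult.left_commute[of c])
qed

text \<open>Every element is a natural multiple of the generator \<open>c = 2 ^ (k - e)\<close>, so
  \<open>F\<close> is determined by \<open>F c\<close>. As \<open>2 ^ e * c = 0\<close>, the value
  \<open>F c\<close> is annihilated by \<open>2 ^ e\<close> and is therefore of the form
  \<open>c * u\<close>; this \<open>u\<close> is the scalar.\<close>

lemma additive_on_pow2_multiples:
  fixes F :: "'k::len word \<Rightarrow> 'k word"
  assumes add: "\<And>x y. x \<in> pow2_multiples e \<Longrightarrow> y \<in> pow2_multiples e \<Longrightarrow> F (x + y) = F x + F y"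
    and e: "e \<le> LENGTH('k)"
  shows "\<exists>u. \<forall>x\<in>pow2_multiples e. F x = u * x"
proof -
  define c :: "'k word" where "c = 2 ^ (LENGTH('k) - e)"
  have c: "c * x \<in> pow2_multiples e" for x by (simp add: c_def pow2_multiples_def)
  have F0: "F 0 = 0" using add[of 0 0] by simp
  have F: "F (of_nat N * c) = of_nat N * F c" for N
  proof (induction N)
    case (Suc N)
    have "F (c + of_nat N * c) = F c + F (of_nat N * c)"
      using c[of "of_nat N"] c[of 1] by (intro add) (simp_all add: mult.commute)
    also have "c + of_nat N * c = of_nat (Suc N) * c" by (simp add: distrib_right)
    finally show ?case by (simp only: Suc) (simp add: distrib_right)
  qed (simp add: F0)
  have "2 ^ e * c = 2 ^ LENGTH('k)" unfolding c_def using e by (simp flip: power_add)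
  then have "2 ^ e * F c = 0" using F[of "2 ^ e"] F0 by simp
  then obtain u where u: "F c = c * u" using annihilated_by_pow2 e unfolding c_def by blast
  have "F x = u * x" if "x \<in> pow2_multiples e" for x
  proof -
    from that obtain y where "x = c * y" by (auto simp: pow2_multiples_def c_def)
    then have "x = of_nat (unat y) * c" by (simp add: mult.commute)
    then show ?thesis using F[of "unat y"] u by (simp add: algebra_simps)
  qed
  then show ?thesis by blast
qed

section \<open>The group of column tails and its additive maps\<close>

text \<open>The columns without their leading 1, as a product of cyclic groups given by one exponent
  per factor.\<close>

definition tails :: "nat list \<Rightarrow> 'k::len word list set" where
  "tails es = listset (map pow2_multiples es)"

lemma tails_Nil [simp]: "tails [] = {[]}"
  and tails_Cons: "tails (e # es) = {x # p |x p. x \<in> pow2_multiples e \<and> p \<in> tails es}"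
  by (auto simp: tails_def set_Cons_def)

lemma Cons_in_tails [simp]:
  "x # p \<in> tails (e # es) \<longleftrightarrow> x \<in> pow2_multiples e \<and> p \<in> tails es"
  by (auto simp: tails_Cons)

lemma length_tails: "p \<in> tails es \<Longrightarrow> length p = length es"
  by (induction es arbitrary: p) (auto simp: tails_Cons)

lemma zero_in_tails: "replicate (length es) 0 \<in> tails es"
  by (induction es) auto

lemma plus_in_tails: "p \<in> tails es \<Longrightarrow> q \<in> tails es \<Longrightarrow> map2 (+) p q \<in> tails es"
  by (induction es arbitrary: p q) (auto simp: tails_Cons)

lemma times_in_tails: "p \<in> tails es \<Longrightarrow> map ((*) c) p \<in> tails es"
  by (induction es arbitrary: p) (auto simp: tails_Cons)

lemma card_set_Cons: "card (set_Cons A B) = card A * card B"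
proof -
  have "set_Cons A B = (\<lambda>(x, p). x # p) ` (A \<times> B)" by (auto simp: set_Cons_def)
  moreover have "inj_on (\<lambda>(x, p). x # p) (A \<times> B)" by (auto simp: inj_on_def)
  ultimately show ?thesis by (simp add: card_image card_cartesian_product)
qed

lemma card_tails:
  assumes "\<forall>e\<in>set es. e \<le> LENGTH('k::len)"
  shows "card (tails es :: 'k word list set) = 2 ^ sum_list es"
  using assms by (induction es) (auto simp: tails_def card_set_Cons card_pow2_multiples power_add)

lemma finite_tails: "finite (tails es :: 'k::len word list set)"
proof (induction es)
  case (Cons e es)
  have "tails (e # es) = (\<lambda>(x, p). x # p) ` (pow2_multiples e \<times> (tails es :: 'k word list set))"
    by (auto simp: tails_Cons)
  with Cons show ?case by simp
qed simp

text \<open>Induction on the factors: \<open>x # p\<close> is the sum of \<open>x # z\<close>, with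
  \<open>z\<close> the zero tail, and \<open>0 # p\<close>. The first summand is handled by the
  cyclic case, the second by the induction hypothesis.\<close>

lemma additive_on_tails:
  fixes F :: "'k::len word list \<Rightarrow> 'k word"
  assumes "\<And>p q. p \<in> tails es \<Longrightarrow> q \<in> tails es \<Longrightarrow> F (map2 (+) p q) = F p + F q"
    and "\<forall>e\<in>set es. e \<le> LENGTH('k)"
  shows "\<exists>u. length u = length es \<and> (\<forall>p\<in>tails es. F p = dot u p)"
  using assms
proof (induction es arbitrary: F)
  case Nil
  from Nil(1)[of "[]" "[]"] show ?case by simp
next
  case (Cons e es)
  define z :: "'k word list" where "z = replicate (length es) 0"
  have z: "z \<in> tails es" by (simp add: z_def zero_in_tails)
  have z_add: "map2 (+) z p = p" if "p \<in> tails es" for p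
    unfolding z_def using length_tails[OF that] by (intro nth_equalityI) auto
  have "\<exists>u. length u = length es \<and> (\<forall>p\<in>tails es. F (0 # p) = dot u p)"
  proof (rule Cons.IH)
    fix p q :: "'k word list" assume "p \<in> tails es" "q \<in> tails es"
    then show "F (0 # map2 (+) p q) = F (0 # p) + F (0 # q)"
      using Cons.prems(1)[of "0 # p" "0 # q"] by simp
  qed (use Cons.prems in simp)
  then obtain u where u: "length u = length es" "\<And>p. p \<in> tails es \<Longrightarrow> F (0 # p) = dot u p" by blast
  have "\<exists>v. \<forall>x\<in>pow2_multiples e. F (x # z) = v * x"
  proof (rule additive_on_pow2_multiples)
    fix x y :: "'k word" assume "x \<in> pow2_multiples e" "y \<in> pow2_multiples e"
    then show "F ((x + y) # z) = F (x # z) + F (y # z)"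
      using Cons.prems(1)[of "x # z" "y # z"] z z_add[of z] by simp
  qed (use Cons.prems in simp)
  then obtain v where v: "\<And>x. x \<in> pow2_multiples e \<Longrightarrow> F (x # z) = v * x" by blast
  have "F (x # p) = dot (v # u) (x # p)" if "x \<in> pow2_multiples e" "p \<in> tails es" for x p
    using Cons.prems(1)[of "x # z" "0 # p"] z z_add u v that by simp
  then show ?case using u(1) by (intro exI[of _ "v # u"]) (auto simp: tails_Cons)
qed

text \<open>On the factor generated by \<open>2 ^ (k - e)\<close> a coefficient acts only through
  its product with this generator. The scaled list is thus a normal form for the function
  \<open>p \<mapsto> dot u p\<close>.\<close>

lemma dot_eq_on_tails_iff:
  fixes u v :: "'k::len word list"
  assumes "length u = length es" "length v = length es"
  shows "(\<forall>p\<in>tails es. dot u p = dot v p) \<longleftrightarrow>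
    map2 (\<lambda>e x. 2 ^ (LENGTH('k) - e) * x) es u = map2 (\<lambda>e x. 2 ^ (LENGTH('k) - e) * x) es v"
  using assms
proof (induction es arbitrary: u v)
  case (Cons e es)
  from Cons.prems obtain a u' b v' where uv: "u = a # u'" "v = b # v'"
    "length u' = length es" "length v' = length es"
    by (auto simp: length_Suc_conv)
  let ?c = "2 ^ (LENGTH('k) - e) :: 'k word"
  have "(\<forall>p\<in>tails (e # es). dot u p = dot v p) \<longleftrightarrow>
      ?c * a = ?c * b \<and> (\<forall>p\<in>tails es. dot u' p = dot v' p)" (is "?A \<longleftrightarrow> ?B")
  proof
    assume A: ?A
    have *: "a * x + dot u' p = b * x + dot v' p" if "x \<in> pow2_multiples e" "p \<in> tails es" for x p
      using that A[rule_format, of "x # p"] uv by simp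
    \<comment> \<open>Tails beginning with 0 isolate \<open>u'\<close> and \<open>v'\<close>; the
      generator followed by zeros isolates \<open>a\<close> and \<open>b\<close>.\<close>
    show ?B
      using *[of 0] *[of ?c "replicate (length es) 0"]
      by (simp add: zero_in_tails dot_zero mult.commute)
  next
    assume B: ?B
    have "a * x = b * x" if "x \<in> pow2_multiples e" for x
    proof -
      from that obtain y where "x = ?c * y" by (auto simp: pow2_multiples_def)
      then have "a * x = (?c * a) * y" "b * x = (?c * b) * y" by (simp_all only: ac_simps)
      then show ?thesis using B by simp
    qed
    then show ?A using B uv by (auto simp: tails_Cons)
  qed
  then show ?case using Cons.IH uv by simp
qed simp

text \<open>The normal forms of \<open>dot_eq_on_tails_iff\<close> are exactly the tails, so there
  are as many functions \<open>p \<mapsto> dot u p\<close> on the group as it has elements.\<close>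

lemma image_scale_eq_tails:
  "(\<lambda>u. map2 (\<lambda>e x. 2 ^ (LENGTH('k) - e) * x) es u) ` {u. length u = length es}
    = (tails es :: 'k::len word list set)" (is "?g es ` _ = _")
proof (induction es)
  case (Cons e es)
  have "{u :: 'k word list. length u = length (e # es)} = (\<lambda>(x, u). x # u) ` (UNIV \<times> {u. length u = length es})"
    by (auto simp: length_Suc_conv image_iff)
  then have "?g (e # es) ` {u. length u = length (e # es)} =
      (\<lambda>(x, u). 2 ^ (LENGTH('k) - e) * x # ?g es u) ` (UNIV \<times> {u. length u = length es})"
    by (simp add: image_image case_prod_beta)
  also have "\<dots> = (\<lambda>(x, p). x # p) ` (pow2_multiples e \<times> ?g es ` {u. length u = length es})"
    by (auto simp: pow2_multiples_def image_iff)
  also have "\<dots> = tails (e # es)"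
    unfolding Cons by (auto simp: tails_Cons)
  finally show ?case .
qed simp

section \<open>Weights of affine functions on the tails\<close>

text \<open>Translation by \<open>m\<close> exchanges 0 and \<open>m\<close>, whose weights are 0
  and \<open>m\<close>; all other words are permuted and weigh \<open>m / 2\<close> each.\<close>

lemma wt_star_add_half:
  fixes x :: "'k::len word"
  shows "wt_star x + wt_star (x + 2 ^ (LENGTH('k) - 1)) = 2 ^ (LENGTH('k) - 1)"
proof -
  let ?h = "2 ^ (LENGTH('k) - 1) :: 'k word"
  have "?h + ?h = 0" using two_times_half[where 'k='k] by (simp only: mult_2)
  then have "x + ?h = 0 \<longleftrightarrow> x = ?h" by (metis add_right_cancel)
  moreover have "x + ?h = ?h \<longleftrightarrow> x = 0" by simp
  ultimately show ?thesis
    using half_nonzero[where 'k='k] by (simp add: wt_star_def Let_def)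
qed

lemma wt_star_ge:
  fixes x :: "'k::len word"
  assumes "x \<noteq> 0"
  shows "wt_star x \<ge> 2 ^ (LENGTH('k) - 1) / 2"
  using assms by (simp add: wt_star_def Let_def)

text \<open>If the linear part vanishes, \<open>c\<close> is nonzero and each term is at least
  \<open>m / 2\<close>. Otherwise a translation adds \<open>m\<close> to every value, and averaging
  the sum with its translate gives \<open>m / 2\<close> per term.\<close>

lemma sum_wt_star_ge:
  fixes c :: "'k::len word"
  assumes u: "length u = length es" and p: "p \<in> tails es" "c + dot u p \<noteq> 0"
  shows "(\<Sum>p\<in>tails es. wt_star (c + dot u p)) \<ge> card (tails es :: 'k word list set) * (2 ^ (LENGTH('k) - 1) / 2)"
proof (cases "\<forall>q\<in>tails es. dot u q = 0")
  case True
  with p have "c \<noteq> 0" by simp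
  with mult_left_mono[OF wt_star_ge[OF this], of "card (tails es :: 'k word list set)"] True
  show ?thesis by (simp del: times_divide_eq_right)
next
  case False
  let ?T = "tails es :: 'k word list set"
  let ?h = "2 ^ (LENGTH('k) - 1) :: 'k word"
  \<comment> \<open>A tail on which the linear part is nonzero is scaled until the value becomes
    \<open>m\<close>; the scaled tail is the translation.\<close>
  from False obtain q y where "q \<in> ?T" "y * dot u q = ?h" using ex_times_eq_half by blast
  then have h: "map ((*) y) q \<in> ?T" "dot u (map ((*) y) q) = ?h"
    by (simp_all add: times_in_tails dot_map_times)
  let ?s = "map2 (+) (map ((*) y) q)"
  have "inj_on ?s ?T"
  proof (rule inj_onI)
    fix a b assume ab: "a \<in> ?T" "b \<in> ?T" "?s a = ?s b"
    have len: "length a = length es" "length b = length es" "length q = length es"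
      using ab h length_tails by force+
    show "a = b"
    proof (rule nth_equalityI)
      fix i assume i: "i < length a"
      have "?s a ! i = ?s b ! i" using ab by simp
      then show "a ! i = b ! i" using i len by simp
    qed (simp add: len)
  qed
  moreover have "?s ` ?T \<subseteq> ?T" using plus_in_tails h(1) by blast
  ultimately have "bij_betw ?s ?T ?T"
    by (simp add: bij_betw_def endo_inj_surj finite_tails)
  then have "(\<Sum>p\<in>?T. wt_star (c + dot u p)) = (\<Sum>p\<in>?T. wt_star (c + dot u (?s p)))"
    by (rule sum.reindex_bij_betw[symmetric])
  also have "\<dots> = (\<Sum>p\<in>?T. wt_star (c + dot u p + ?h))"
  proof (rule sum.cong)
    fix p assume "p \<in> ?T"
    then have "dot u (?s p) = ?h + dot u p"
      using h u length_tails by (subst dot_map2_plus) force+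
    then show "wt_star (c + dot u (?s p)) = wt_star (c + dot u p + ?h)" by (simp add: ac_simps)
  qed simp
  finally have "2 * (\<Sum>p\<in>?T. wt_star (c + dot u p)) =
      (\<Sum>p\<in>?T. wt_star (c + dot u p) + wt_star (c + dot u p + ?h))"
    by (simp add: sum.distrib)
  also have "\<dots> = card ?T * 2 ^ (LENGTH('k) - 1)" by (simp only: wt_star_add_half) simp
  finally show ?thesis by simp
qed

section \<open>Columns of the matrix, its row space and the dual of its kernel\<close>

text \<open>One exponent for each row below the row of ones. The entries add up to the
  \<open>r\<close> of the theorem, which yields \<open>2 ^ r\<close> tails.\<close>

definition exponents :: "nat \<Rightarrow> (nat \<Rightarrow> nat) \<Rightarrow> nat list" where
  "exponents k I = concat (map (\<lambda>j. replicate (I j) j) [1..<k + 1])"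

lemma set_exponents: "e \<in> set (exponents k I) \<Longrightarrow> e \<le> k"
  by (auto simp: exponents_def)

lemma length_exponents: "length (exponents k I) = (\<Sum>j=1..k. I j)"
  by (induction k) (simp_all add: exponents_def)

lemma sum_list_exponents: "sum_list (exponents k I) = (\<Sum>j=1..k. j * I j)"
  by (induction k) (simp_all add: exponents_def sum_list_replicate)

lemma B_columns_eq: "(B_columns I :: 'k::len word list set) = (#) 1 ` tails (exponents LENGTH('k) I)"
  by (auto simp: B_columns_def tails_def exponents_def map_concat o_def set_Cons_def pow2_multiples_def)

lemma dot_eq_sum: "length p = length u \<Longrightarrow> dot u p = (\<Sum>i = 0..<length u. u ! i * p ! i)"
  by (simp add: dot_def sum_list_sum_nth)

lemma transpose_cols_list_mult:
  assumes "\<forall>c\<in>set cs. length c = l" "u \<in> carrier_vec l"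
  shows "transpose_mat (mat_of_cols_list l cs) *\<^sub>v u = vec (length cs) (\<lambda>i. dot (list_of_vec u) (cs ! i))"
proof (rule eq_vecI)
  fix i assume "i < dim_vec (vec (length cs) (\<lambda>i. dot (list_of_vec u) (cs ! i)))"
  then have i: "i < length cs" by simp
  have "length (cs ! i) = l" using i assms by simp
  then show "(transpose_mat (mat_of_cols_list l cs) *\<^sub>v u) $ i =
      vec (length cs) (\<lambda>i. dot (list_of_vec u) (cs ! i)) $ i"
    using i assms(2)
    by (simp add: mat_of_cols_list_def scalar_prod_def dot_eq_sum mult.commute list_of_vec_index)
qed (simp add: mat_of_cols_list_def)

text \<open>Passes from the generator matrix to evaluation on the list of columns, the form in which
  the code is studied.\<close>

lemma range_transpose_cols_list:
  assumes "\<forall>c\<in>set cs. length c = l"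
  shows "{transpose_mat (mat_of_cols_list l cs) *\<^sub>v u |u. u \<in> carrier_vec l} =
    (\<lambda>v. vec (length cs) (\<lambda>i. dot v (cs ! i))) ` {v. length v = l}" (is "?A = ?f ` _")
proof -
  have "?A = ?f ` list_of_vec ` carrier_vec l"
    using transpose_cols_list_mult[OF assms] by (auto simp: image_iff) metis+
  also have "list_of_vec ` carrier_vec l = {v :: 'a list. length v = l}"
    by (auto simp: image_iff) (metis carrier_vec_dim_vec dim_vec_of_list list_vec)
  finally show ?thesis .
qed

lemma linear_code_dual: "linear_code n (dual_code n C)" if "C \<subseteq> carrier_vec n"
  using that unfolding linear_code_def dual_code_def
  by (auto simp: add_scalar_prod_distrib[of _ n] subset_iff)

text \<open>A word orthogonal to the kernel is an affine function of the columns, because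
  \<open>e\<^bsub>p+q\<^esub> - e\<^sub>p - e\<^sub>q + e\<^sub>0\<close> lies in the kernel for all tails \<open>p\<close>, \<open>q\<close>.\<close>

lemma dual_kernel_eq_row_space:
  fixes cs :: "'k::len word list list"
  assumes es: "\<forall>e\<in>set es. e \<le> LENGTH('k)"
    and cs: "set cs = (#) 1 ` tails es"
  shows "dual_code (length cs) (mat_kernel (mat_of_cols_list (Suc (length es)) cs)) =
    (\<lambda>v. vec (length cs) (\<lambda>i. dot v (cs ! i))) ` {v. length v = Suc (length es)}"
proof -
  let ?l = "Suc (length es)" and ?n = "length cs"
  let ?B = "mat_of_cols_list ?l cs"
  have B: "?B \<in> carrier_mat ?l ?n" by (simp add: mat_of_cols_list_def)
  have len: "\<forall>c\<in>set cs. length c = ?l" using cs by (auto simp: length_tails)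
  \<comment> \<open>The row space is orthogonal to the kernel: move the matrix across the scalar
    product.\<close>
  have "x \<in> dual_code ?n (mat_kernel ?B)" if "length v = ?l" "x = vec ?n (\<lambda>i. dot v (cs ! i))" for x v
  proof -
    have "x \<in> {transpose_mat ?B *\<^sub>v u |u. u \<in> carrier_vec ?l}"
      unfolding range_transpose_cols_list[OF len] using that by simp
    then obtain u where u: "u \<in> carrier_vec ?l" "x = transpose_mat ?B *\<^sub>v u" by auto
    have "x \<bullet> y = 0" if "y \<in> mat_kernel ?B" for y
    proof -
      have y: "y \<in> carrier_vec ?n" "?B *\<^sub>v y = 0\<^sub>v ?l" using that mat_kernel[OF B] by auto
      show ?thesis unfolding u(2) transpose_vec_mult_scalar[OF B y(1) u(1)] y(2) using u(1) by simp
    qed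
    then show ?thesis using that(2) by (simp add: dual_code_def)
  qed
  moreover have "\<exists>v. length v = ?l \<and> x = vec ?n (\<lambda>i. dot v (cs ! i))"
    if x: "x \<in> dual_code ?n (mat_kernel ?B)" for x
  proof -
    have xc: "x \<in> carrier_vec ?n" using x by (simp add: dual_code_def)
    have "\<exists>i<?n. cs ! i = 1 # p" if "p \<in> tails es" for p
    proof -
      have "1 # p \<in> set cs" using that cs by blast
      then show ?thesis by (simp add: in_set_conv_nth)
    qed
    then obtain ix where ix: "\<And>p. p \<in> tails es \<Longrightarrow> ix p < ?n \<and> cs ! ix p = 1 # p" by metis
    define o' :: "'k word list" where "o' = replicate (length es) 0"
    have o': "o' \<in> tails es" unfolding o'_def by (rule zero_in_tails)
    have rel: "x $ j - x $ i1 - x $ i2 + x $ i0 = 0"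
      if i: "j < ?n" "i1 < ?n" "i2 < ?n" "i0 < ?n"
        and e: "\<And>t. t < ?l \<Longrightarrow> cs ! j ! t - cs ! i1 ! t - cs ! i2 ! t + cs ! i0 ! t = 0" for j i1 i2 i0
    proof -
      let ?e = "unit_vec ?n :: nat \<Rightarrow> 'k word vec"
      let ?h = "?e j - ?e i1 - ?e i2 + ?e i0"
      have "(?B *\<^sub>v ?h) $ t = 0" if t: "t < ?l" for t
      proof -
        have r: "row ?B t \<in> carrier_vec ?n" using B by (simp add: carrier_vecI)
        have "(?B *\<^sub>v ?h) $ t = row ?B t \<bullet> ?h" using t B by simp
        also have "\<dots> = row ?B t $ j - row ?B t $ i1 - row ?B t $ i2 + row ?B t $ i0"
          using r i by (simp add: scalar_prod_add_distrib[of _ ?n] scalar_prod_minus_distrib[of _ ?n])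
        also have "\<dots> = 0" using e[OF t] i t by (simp add: mat_of_cols_list_def)
        finally show ?thesis .
      qed
      then have "?B *\<^sub>v ?h = 0\<^sub>v ?l" using B by (intro eq_vecI) auto
      then have "?h \<in> mat_kernel ?B" using mat_kernel[OF B] by auto
      then have "x \<bullet> ?h = 0" using x by (auto simp: dual_code_def)
      then show ?thesis
        using xc i by (simp add: scalar_prod_add_distrib[of _ ?n] scalar_prod_minus_distrib[of _ ?n])
    qed
    \<comment> \<open>Subtracting the value at the zero tail leaves the linear part; the subtracted
      constant becomes the coefficient of the row of ones.\<close>
    define F where "F p = x $ ix p - x $ ix o'" for p
    have "\<exists>u. length u = length es \<and> (\<forall>p\<in>tails es. F p = dot u p)"
    proof (rule additive_on_tails)
      fix p q :: "'k word list" assume p: "p \<in> tails es" and q: "q \<in> tails es"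
      note pq = plus_in_tails[OF p q]
      have "x $ ix (map2 (+) p q) - x $ ix p - x $ ix q + x $ ix o' = 0"
      proof (rule rel)
        fix t assume t: "t < ?l"
        show "cs ! ix (map2 (+) p q) ! t - cs ! ix p ! t - cs ! ix q ! t + cs ! ix o' ! t = 0"
          using t ix[OF p] ix[OF q] ix[OF pq] ix[OF o'] length_tails[OF p] length_tails[OF q]
          by (cases t) (auto simp: o'_def)
      qed (use ix[OF p] ix[OF q] ix[OF pq] ix[OF o'] in auto)
      then show "F (map2 (+) p q) = F p + F q" by (simp add: F_def algebra_simps)
    qed (use es in auto)
    then obtain u where u: "length u = length es" "\<And>p. p \<in> tails es \<Longrightarrow> F p = dot u p" by blast
    have "x $ i = dot (x $ ix o' # u) (cs ! i)" if i: "i < ?n" for i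
    proof -
      have "cs ! i \<in> (#) 1 ` tails es" using i cs by auto
      then obtain p where p: "p \<in> tails es" "cs ! i = 1 # p" by blast
      \<comment> \<open>With \<open>i2 = i0 = ix o'\<close> the relation says that \<open>x\<close>
        has equal entries at positions carrying the same column.\<close>
      have "x $ i - x $ ix p - x $ ix o' + x $ ix o' = 0"
        using ix[OF p(1)] ix[OF o'] i p(2) by (intro rel) auto
      then have "x $ i = x $ ix p" by simp
      then show ?thesis using u(2)[OF p(1)] p(2) by (simp add: F_def algebra_simps)
    qed
    then show ?thesis using xc u(1) by (intro exI[of _ "x $ ix o' # u"]) (auto intro!: eq_vecI)
  qed
  ultimately show ?thesis by (intro equalityI subsetI) (blast, force)
qed

section \<open>Size and minimum distance of the row space\<close>

text \<open>Lets codewords be counted through their normal forms, without choosing one coefficient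
  list for each codeword.\<close>

lemma card_image_eq_if_same_fibres:
  assumes "\<And>x y. x \<in> A \<Longrightarrow> y \<in> A \<Longrightarrow> f x = f y \<longleftrightarrow> g x = g y"
  shows "card (f ` A) = card (g ` A)"
proof (rule bij_betw_same_card)
  define h where "h z = g (SOME x. x \<in> A \<and> f x = z)" for z
  have h: "h (f x) = g x" if "x \<in> A" for x
  proof -
    have "(SOME y. y \<in> A \<and> f y = f x) \<in> A \<and> f (SOME y. y \<in> A \<and> f y = f x) = f x"
      using that by (intro someI[of "\<lambda>y. y \<in> A \<and> f y = f x" x]) simp
    then show ?thesis using assms that unfolding h_def by blast
  qed
  show "bij_betw h (f ` A) (g ` A)"
    using h assms unfolding bij_betw_def inj_on_def by (auto simp: image_iff)
qed

text \<open>A codeword determines its constant term, by evaluation at the zero tail, and hence its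
  linear part. There are \<open>2 ^ k\<close> constants and as many linear parts as tails.\<close>

lemma card_row_space:
  fixes cs :: "'k::len word list list"
  assumes es: "\<forall>e\<in>set es. e \<le> LENGTH('k)"
    and cs: "set cs = (#) 1 ` tails es"
  shows "card ((\<lambda>v. vec (length cs) (\<lambda>i. dot v (cs ! i))) ` {v. length v = Suc (length es)}) =
    2 ^ sum_list es * 2 ^ LENGTH('k)"
proof -
  let ?f = "\<lambda>v. vec (length cs) (\<lambda>i. dot v (cs ! i))"
  let ?s = "\<lambda>u. map2 (\<lambda>e x. 2 ^ (LENGTH('k) - e) * x) es u"
  let ?g = "\<lambda>v. (hd v, ?s (tl v))"
  let ?A = "{v :: 'k word list. length v = Suc (length es)}"
  have "card (?f ` ?A) = card (?g ` ?A)"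
  proof (rule card_image_eq_if_same_fibres)
    fix v w :: "'k word list" assume "v \<in> ?A" "w \<in> ?A"
    then obtain a u b u' where vw: "v = a # u" "w = b # u'" "length u = length es" "length u' = length es"
      by (auto simp: length_Suc_conv)
    have "?f v = ?f w \<longleftrightarrow> (\<forall>i<length cs. dot v (cs ! i) = dot w (cs ! i))"
      by (auto simp: vec_eq_iff)
    also have "\<dots> \<longleftrightarrow> (\<forall>c\<in>set cs. dot v c = dot w c)"
      by (simp add: all_set_conv_all_nth)
    also have "\<dots> \<longleftrightarrow> (\<forall>p\<in>tails es. a + dot u p = b + dot u' p)" unfolding cs vw by simp
    also have "\<dots> \<longleftrightarrow> a = b \<and> (\<forall>p\<in>tails es. dot u p = dot u' p)"
    proof
      assume *: "\<forall>p\<in>tails es. a + dot u p = b + dot u' p"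
      with zero_in_tails[of es] have "a = b" by (force simp: dot_zero)
      with * show "a = b \<and> (\<forall>p\<in>tails es. dot u p = dot u' p)" by simp
    qed simp
    also have "\<dots> \<longleftrightarrow> ?g v = ?g w" unfolding dot_eq_on_tails_iff[OF vw(3,4)] vw(1,2) by simp
    finally show "?f v = ?f w \<longleftrightarrow> ?g v = ?g w" .
  qed
  also have "?g ` ?A = UNIV \<times> ?s ` {u. length u = length es}"
  proof -
    have "?A = (\<lambda>(a, u). a # u) ` (UNIV \<times> {u. length u = length es})"
      by (auto simp: length_Suc_conv image_iff)
    then show ?thesis by (auto simp: image_image image_iff)
  qed
  also have "card \<dots> = 2 ^ sum_list es * 2 ^ LENGTH('k)"
    unfolding image_scale_eq_tails
    by (simp add: card_cartesian_product card_tails[OF es] card_word)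
  finally show ?thesis .
qed

text \<open>The difference of two codewords is again affine on the tails, with constant
  \<open>b - a\<close> and linear part \<open>d\<close>. As the columns are distinct, the sum over
  positions is a sum over tails, to which \<open>sum_wt_star_ge\<close> applies.\<close>

lemma d_star_row_space_ge:
  fixes cs :: "'k::len word list list"
  assumes cs: "distinct cs" "set cs = (#) 1 ` tails es"
    and len: "length v = Suc (length es)" "length w = Suc (length es)"
    and ne: "vec (length cs) (\<lambda>i. dot v (cs ! i)) \<noteq> vec (length cs) (\<lambda>i. dot w (cs ! i))"
  shows "d_star (vec (length cs) (\<lambda>i. dot v (cs ! i))) (vec (length cs) (\<lambda>i. dot w (cs ! i))) \<ge>
    length cs * (2 ^ (LENGTH('k) - 1) / 2)"
proof -
  from len obtain a u b u' where vw: "v = a # u" "w = b # u'" "length u = length es" "length u' = length es"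
    by (auto simp: length_Suc_conv)
  let ?T = "tails es :: 'k word list set"
  define d where "d = map2 (-) u' u"
  have d: "length d = length es" using vw by (simp add: d_def)
  have dot_d: "dot d p = dot u' p - dot u p" if "p \<in> ?T" for p
    using length_tails[OF that] vw(3,4)
    by (simp add: dot_eq_sum d_def algebra_simps sum_subtractf)
  have dw: "dot w (1 # p) - dot v (1 # p) = (b - a) + dot d p" if "p \<in> ?T" for p
    using dot_d[OF that] vw by (simp add: algebra_simps)
  have card: "length cs = card ?T"
    using distinct_card[OF cs(1)] cs(2) card_image[of "(#) 1" ?T] by (simp add: inj_on_def)
  obtain i where i: "i < length cs" "dot v (cs ! i) \<noteq> dot w (cs ! i)"
    using ne by (auto simp: vec_eq_iff)
  moreover obtain p where p: "p \<in> ?T" "cs ! i = 1 # p"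
    using i(1) cs(2) nth_mem[of i cs] by auto
  ultimately have nz: "(b - a) + dot d p \<noteq> 0" using dw[OF p(1)] by auto
  have "length cs * (2 ^ (LENGTH('k) - 1) / 2) \<le> (\<Sum>p\<in>?T. wt_star ((b - a) + dot d p))"
    unfolding card by (rule sum_wt_star_ge[OF d p(1) nz])
  also have "\<dots> = (\<Sum>p\<in>?T. wt_star (dot w (1 # p) - dot v (1 # p)))"
    using dw by simp
  also have "\<dots> = (\<Sum>c\<in>set cs. wt_star (dot w c - dot v c))"
    unfolding cs(2) by (subst sum.reindex) (auto simp: inj_on_def)
  also have "\<dots> = (\<Sum>i<length cs. wt_star (dot w (cs ! i) - dot v (cs ! i)))"
    by (rule sum.reindex_bij_betw[symmetric]) (rule bij_betw_nth[OF cs(1)], auto)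
  finally show ?thesis by (simp add: d_star_def)
qed

section \<open>The map \<open>phi\<close> and Hamming distances\<close>

lemma hamming_dist_refl: "hamming_dist x x = 0"
  by (simp add: hamming_dist_def)

text \<open>Counting in zipped lists is additive under concatenation of aligned blocks, as required
  for \<open>phi\<close>.\<close>

lemma hamming_dist_vec_of_list:
  assumes "length xs = length ys"
  shows "hamming_dist (vec_of_list xs) (vec_of_list ys) = length (filter (\<lambda>(x, y). x \<noteq> y) (zip xs ys))"
  unfolding hamming_dist_def length_filter_conv_card
  using assms by (auto intro!: arg_cong[of _ _ card] simp: vec_of_list_index)

lemma hamming_dist_list_of_vec:
  assumes "dim_vec x = dim_vec y"
  shows "length (filter (\<lambda>(x, y). x \<noteq> y) (zip (list_of_vec x) (list_of_vec y))) = hamming_dist x y"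
  using hamming_dist_vec_of_list[of "list_of_vec x" "list_of_vec y"] assms by (simp add: vec_list)

lemma phi_carrier:
  assumes "\<And>c :: 'k::len word. a (unat c) \<in> carrier_vec m" "x \<in> carrier_vec n"
  shows "phi a (x :: 'k word vec) \<in> carrier_vec (n * m)"
proof -
  have "dim_vec (a (unat c)) = m" for c :: "'k word" using assms(1)[of c] by simp
  then show ?thesis
    using assms(2) unfolding phi_def
    by (intro carrier_vecI) (simp add: length_concat o_def sum_list_triv)
qed

text \<open>All blocks have the same length \<open>m\<close>, so the blocks of two images are
  aligned and the distance is the sum of the block distances.\<close>

lemma hamming_dist_phi_ge:
  fixes x y :: "'k::len word vec"
  assumes a: "\<And>c :: 'k word. a (unat c) \<in> carrier_vec m"
    and dist: "\<And>c d :: 'k word. real (hamming_dist (a (unat c)) (a (unat d))) \<ge> wt_star (d - c)"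
    and xy: "x \<in> carrier_vec n" "y \<in> carrier_vec n"
  shows "real (hamming_dist (phi a x) (phi a y)) \<ge> d_star x y"
proof -
  let ?F = "\<lambda>xs. concat (map (\<lambda>c. list_of_vec (a (unat c))) (xs :: 'k word list))"
  have len: "length (list_of_vec (a (unat c))) = m" for c :: "'k word" using a[of c] by simp
  have lenF: "length (?F xs) = length xs * m" for xs :: "'k word list"
    using len by (simp add: length_concat o_def sum_list_triv)
  have *: "real (length (filter (\<lambda>(x, y). x \<noteq> y) (zip (?F xs) (?F ys)))) \<ge>
      sum_list (map2 (\<lambda>c d. wt_star (d - c)) xs ys)" if "length xs = length ys" for xs ys
    using that
  proof (induction xs ys rule: list_induct2)
    case (Cons c xs d ys)
    have "length (filter (\<lambda>(x, y). x \<noteq> y) (zip (?F (c # xs)) (?F (d # ys)))) =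
        hamming_dist (a (unat c)) (a (unat d)) + length (filter (\<lambda>(x, y). x \<noteq> y) (zip (?F xs) (?F ys)))"
      using a[of c] a[of d] by (simp add: hamming_dist_list_of_vec[symmetric])
    then show ?case using Cons.IH dist[where c=c and d=d] by simp
  qed simp
  have "d_star x y = sum_list (map2 (\<lambda>c d. wt_star (d - c)) (list_of_vec x) (list_of_vec y))"
    using xy by (simp add: d_star_def sum_list_sum_nth atLeast0LessThan list_of_vec_index)
  also have "\<dots> \<le> real (length (filter (\<lambda>(x, y). x \<noteq> y) (zip (?F (list_of_vec x)) (?F (list_of_vec y)))))"
    using xy by (intro *) simp
  also have "\<dots> = real (hamming_dist (phi a x) (phi a y))"
    unfolding phi_def using xy lenF by (subst hamming_dist_vec_of_list) simp_all
  finally show ?thesis .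
qed

text \<open>Indices differing by \<open>m\<close> belong to complementary words, at distance
  \<open>m\<close>; any other two distinct indices belong to distinct words, at distance at least
  \<open>m / 2\<close>.\<close>

lemma wt_star_le_hamming_dist:
  fixes c d :: "'k::len word"
  assumes m: "m = 2 ^ (LENGTH('k) - 1)"
    and A: "binary_code m (2 * m) (real m / 2) (a ` {..<2 * m})"
    and compl: "\<forall>i<m. a i + a (i + m) = vec m (\<lambda>_. 1 :: bit)"
  shows "wt_star (d - c) \<le> real (hamming_dist (a (unat c)) (a (unat d)))"
proof -
  have L: "2 ^ LENGTH('k) = 2 * m"
    unfolding m by (metis One_nat_def Suc_pred len_gt_0 power_Suc)
  have lt: "unat x < 2 * m" for x :: "'k word"
    unfolding L[symmetric] by (rule unsigned_less)
  have a_dim: "dim_vec (a i) = m" if "i < 2 * m" for i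
    using A that by (force simp: binary_code_def)
  \<comment> \<open>The code has as many words as there are indices, so no word occurs
    twice.\<close>
  have inj: "inj_on a {..<2 * m}"
    using A by (intro eq_card_imp_inj_on) (auto simp: binary_code_def)
  have far: "{j. j < m \<and> a i $ j \<noteq> a (i + m) $ j} = {..<m}" if i: "i < m" for i
  proof -
    have "a i $ j \<noteq> a (i + m) $ j" if j: "j < m" for j
    proof
      assume eq: "a i $ j = a (i + m) $ j"
      have "(a i + a (i + m)) $ j = 1" using compl i j by simp
      then show False using i j a_dim[of "i + m"] eq by simp
    qed
    then show ?thesis by auto
  qed
  consider "d = c" | "d - c = of_nat m" | "d \<noteq> c" "d - c \<noteq> of_nat m" by blast
  then show ?thesis
  proof cases
    case 1
    then show ?thesis by (simp add: wt_star_def)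
  next
    case 2
    then have "d = of_nat (unat c + m)" by (simp add: algebra_simps)
    then have d: "unat d = (unat c + m) mod (2 * m)" by (simp only: unat_of_nat L)
    have "hamming_dist (a (unat c)) (a (unat d)) = m"
    proof (cases "unat c < m")
      case True
      then have "unat d = unat c + m" using d by simp
      then show ?thesis using far[OF True] a_dim[OF lt] by (simp add: hamming_dist_def)
    next
      case False
      \<comment> \<open>Here adding \<open>m\<close> wraps around modulo \<open>2 * m\<close>, so
        \<open>d\<close> has the smaller index and the complementary pair is read in the other
        order.\<close>
      then have "unat c + m = (unat c - m) + 2 * m" by simp
      then have "unat d = (unat c - m) mod (2 * m)" using d by (simp only: mod_add_self2)
      then have "unat d = unat c - m" using lt[of c] by simp
      then have *: "unat c = unat d + m" "unat d < m" using False lt[of c] by auto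
      then show ?thesis using far[OF *(2)] a_dim[OF lt, of c]
        by (simp add: hamming_dist_def eq_commute[of "a (unat d + m) $ _"])
    qed
    moreover have "wt_star (d - c) \<le> real m" by (simp add: wt_star_def Let_def m)
    ultimately show ?thesis by simp
  next
    case 3
    then have "unat c \<noteq> unat d" using word_unat_eq_iff[of d c] by simp
    then have "a (unat c) \<noteq> a (unat d)" using inj lt by (auto dest: inj_onD)
    then have "real m / 2 \<le> real (hamming_dist (a (unat c)) (a (unat d)))"
      using A lt by (simp add: binary_code_def)
    moreover have "wt_star (d - c) = real m / 2"
      using 3 by (simp add: wt_star_def Let_def m)
    ultimately show ?thesis by simp
  qed
qed

section \<open>Parameters of the code and of its binary image\<close>

theorem theorem3:
  fixes k m r n :: nat
    and I :: "nat \<Rightarrow> nat"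
    and a :: "nat \<Rightarrow> bit vec"
    and \<D> :: "'k::len word vec set"
  assumes "LENGTH('k) = k"
    and "m = 2 ^ (k - 1)"
    and "n = 2 ^ r"
    and "(\<Sum>j=1..k. j * I j) = r"
    and "binary_code m (2 * m) (real m / 2) (a ` {..<2 * m})"
    and "a 0 = 0\<^sub>v m"
    and "\<forall>i<m. a i + a (i + m) = vec m (\<lambda>_. 1)"
    and "\<D> = dual_code n (H_code I)"
  shows "linear_code n \<D> \<and>
    star_code n (n * 2 ^ k) (real n * 2 powi (int k - 2)) \<D> \<and>
    generator_matrix n (B_mat I) \<D> \<and>
    binary_code (n * 2 ^ (k - 1)) (n * 2 ^ k) (real n * 2 powi (int k - 2)) (phi a ` \<D>) \<and>
    hadamard_code (n * 2 ^ (k - 1)) (phi a ` \<D>)"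
proof -
  define es where "es = exponents k I"
  define cs where "cs = sorted_list_of_set (B_columns I :: 'k word list set)"
  define f where "f = (\<lambda>v :: 'k word list. vec n (\<lambda>i. dot v (cs ! i)))"
  have es: "\<forall>e\<in>set es. e \<le> LENGTH('k)"
    using set_exponents assms(1) by (auto simp: es_def)
  have cols: "(B_columns I :: 'k word list set) = (#) 1 ` tails es"
    using B_columns_eq[where 'k='k] assms(1) by (simp add: es_def)
  have fin: "finite (B_columns I :: 'k word list set)" by (simp add: cols finite_tails)
  have cs: "distinct cs" "set cs = (#) 1 ` tails es"
    using fin cols by (simp_all add: cs_def)
  have "length cs = card (tails es :: 'k word list set)"
    using cols by (simp add: cs_def card_image)
  then have n: "length cs = n"
    using card_tails[OF es] assms(3,4) by (simp add: es_def sum_list_exponents)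
  have B: "B_mat I = mat_of_cols_list (Suc (length es)) cs"
    using assms(1) by (simp add: B_mat_def cs_def es_def length_exponents)
  have B_carrier: "mat_of_cols_list (Suc (length es)) cs \<in> carrier_mat (Suc (length es)) n"
    by (simp add: mat_of_cols_list_def n)
  have D: "\<D> = f ` {v. length v = Suc (length es)}"
    using dual_kernel_eq_row_space[OF es cs(2)] assms(8)
    unfolding n f_def H_code_def B by simp
  have "H_code I \<subseteq> (carrier_vec n :: 'k word vec set)"
    unfolding H_code_def B mat_kernel[OF B_carrier] by auto
  then have linear: "linear_code n \<D>"
    unfolding assms(8) by (rule linear_code_dual)
  have "\<D> = {transpose_mat (B_mat I) *\<^sub>v u |u. u \<in> carrier_vec (Suc (length es))}"
    unfolding B D using range_transpose_cols_list[of cs "Suc (length es)"] cs(2)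
    by (auto simp: length_tails f_def n)
  then have generator: "generator_matrix n (B_mat I) \<D>"
    using B_carrier by (simp add: generator_matrix_def B)
  have k: "k \<ge> 1" using assms(1) len_gt_0[where 'a='k] by linarith
  \<comment> \<open>The exponent is -1 for \<open>k = 1\<close>. Splitting it as
    \<open>(k - 1) - 1\<close> exhibits the power as \<open>m / 2\<close>.\<close>
  have "(2 :: real) powi (int k - 2) = 2 powi (int (k - 1) - 1)" using k by (simp add: of_nat_diff)
  also have "\<dots> = real m / 2"
    unfolding assms(2) by (subst power_int_diff) simp_all
  finally have powi: "(2 :: real) powi (int k - 2) = real m / 2" .
  have D_carrier: "\<D> \<subseteq> carrier_vec n" using linear by (simp add: linear_code_def)
  have card: "card \<D> = n * 2 ^ k"
    using card_row_space[OF es cs(2)] assms(1,3,4)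
    by (simp add: D f_def n es_def sum_list_exponents)
  \<comment> \<open>Infinite sets have \<open>card\<close> 0, so a positive cardinality gives
    finiteness.\<close>
  then have fin_D: "finite \<D>" using assms(3) by (simp add: card_ge_0_finite)
  have dist: "d_star x y \<ge> real n * 2 powi (int k - 2)" if "x \<in> \<D>" "y \<in> \<D>" "x \<noteq> y" for x y
    using that d_star_row_space_ge[OF cs] assms(1,2) unfolding powi D f_def n by auto
  have star: "star_code n (n * 2 ^ k) (real n * 2 powi (int k - 2)) \<D>"
    unfolding star_code_def using D_carrier card fin_D dist by blast
  have "(2 :: nat) ^ k = 2 * m" using k assms(2) by (cases k) auto
  then have a_carrier: "a (unat c) \<in> carrier_vec m" for c :: "'k word"
    using assms(5) unsigned_less[of c, where 'a=nat] by (auto simp: binary_code_def assms(1))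
  have "m = 2 ^ (LENGTH('k) - 1)" using assms(1,2) by simp
  note blocks = wt_star_le_hamming_dist[OF this assms(5,7)]
  have hdist: "real (hamming_dist (phi a x) (phi a y)) \<ge> real n * 2 powi (int k - 2)"
    if "x \<in> \<D>" "y \<in> \<D>" "x \<noteq> y" for x y
    using dist[OF that] hamming_dist_phi_ge[where a=a and m=m, OF a_carrier blocks, of x n y] D_carrier that
    by fastforce
  \<comment> \<open>Distinct codewords have images at positive distance, so \<open>phi a\<close> is
    injective on the code and preserves its size.\<close>
  have "real n * 2 powi (int k - 2) > 0" using assms(3) by simp
  then have "inj_on (phi a) \<D>"
    using hdist by (intro inj_onI) (force simp: hamming_dist_refl)
  then have "card (phi a ` \<D>) = n * 2 ^ k" by (simp add: card_image card)
  moreover have "phi a ` \<D> \<subseteq> carrier_vec (n * m)"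
    using phi_carrier[where a=a and m=m, OF a_carrier] D_carrier by blast
  ultimately have binary:
    "binary_code (n * 2 ^ (k - 1)) (n * 2 ^ k) (real n * 2 powi (int k - 2)) (phi a ` \<D>)"
    unfolding binary_code_def using fin_D hdist assms(2) by auto
  \<comment> \<open>For \<open>N = n * m\<close> one has \<open>2 * N = n * 2 ^ k\<close> and
    \<open>N / 2 = n * (m / 2)\<close>.\<close>
  then have "hadamard_code (n * 2 ^ (k - 1)) (phi a ` \<D>)"
    unfolding hadamard_code_def using powi assms(2) \<open>2 ^ k = 2 * m\<close> by (simp add: mult.left_commute)
  with linear star generator binary show ?thesis by blast
qed

end
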